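(* Let $m>0$ and $a\in\mathbb{R}$ with $0<a^2\le m^2$. Then the stationary Kerr spacetime $$M^a=\mathbb{R}\times\{x\in\mathbb{R}^3: r>m+\sqrt{m^2-a^2\cos^2\theta}\},$$ endowed with the Kerr metric of parameters $m,a$, is not geodesically connected.
   Context: $(r,\theta,\varphi)$ are the usual spherical coordinates on $\mathbb{R}^3$ and $t$ is the coordinate on the factor $\mathbb{R}$ (Boyer–Lindquist coordinates). The Kerr metric with mass $m>0$ and angular momentum $ma$ is $$ds^2=g_{4,4}\,dt^2+g_{1,1}\,dr^2+g_{2,2}\,d\theta^2+g_{3,3}\,d\varphi^2+2g_{3,4}\,dt\,d\varphi,$$ with $\lambda(r,\theta)=r^2+a^2\cos^2\theta$, $\triangle(r)=r^2-2mr+a^2$, and $$g_{1,1}=\frac{\lambda}{\triangle},\quad g_{2,2}=\lambda,\quad g_{3,3}=\Big[r^2+a^2+\frac{2mra^2\sin^2\theta}{\lambda}\Big]\sin^2\theta,\quad g_{3,4}=-\frac{2mra\sin^2\theta}{\lambda},\quad g_{4,4}=-1+\frac{2mr}{\lambda}.$$ The metric extends smoothly across the axis $\theta\in\{0,\pi\}$. $M^a$ is the region outside the hypersurface $r=m+\sqrt{m^2-a^2\cos^2\theta}$ on which $\beta=-g_{4,4}$ vanishes; on $M^a$ one has $\beta>0$. A spacetime is geodesically connected if any two of its points can be joined by a geodesic (of any causal character) contained in it. *)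

theory Defs
  imports "HOL-Analysis.Analysis"
begin

section \<open>Geodesics of a metric on an open subset of a coordinate space\<close>

text \<open>
  A (semi-Riemannian) metric is given by its symmetric component matrix with respect to the
  standard coordinates, as a function of the point.
\<close>

definition partial_deriv :: "'n::finite \<Rightarrow> (real^'n \<Rightarrow> real) \<Rightarrow> real^'n \<Rightarrow> real" where
  "partial_deriv k f p = deriv (\<lambda>h. f (p + h *\<^sub>R axis k 1)) 0"

text \<open>Christoffel symbols of the second kind; \<open>k\<close> is the upper index.\<close>

definition christoffel ::
    "(real^'n \<Rightarrow> real^'n^'n) \<Rightarrow> real^'n \<Rightarrow> 'n::finite \<Rightarrow> 'n \<Rightarrow> 'n \<Rightarrow> real" where
  "christoffel g p k i j =
     (\<Sum>l\<in>UNIV. matrix_inv (g p) $ k $ l *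
        (partial_deriv i (\<lambda>q. g q $ j $ l) p
         + partial_deriv j (\<lambda>q. g q $ i $ l) p
         - partial_deriv l (\<lambda>q. g q $ i $ j) p)) / 2"

text \<open>
  Solutions of class \<open>C\<^sup>2\<close> of the geodesic equation are as smooth as the metric allows, and on an
  open set solutions on a compact interval extend beyond its end points; so requiring two
  derivatives, one-sided at the end points, is no restriction.
\<close>

definition geodesic_on ::
    "(real^'n \<Rightarrow> real^'n^'n) \<Rightarrow> (real^'n) set \<Rightarrow> real set \<Rightarrow> (real \<Rightarrow> real^'n::finite) \<Rightarrow> bool" where
  "geodesic_on g M I \<gamma> \<longleftrightarrow>
     (\<forall>s\<in>I. \<gamma> s \<in> M) \<and>
     (\<exists>v w. \<forall>s\<in>I.
        (\<gamma> has_vector_derivative v s) (at s within I) \<and>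
        (v has_vector_derivative w s) (at s within I) \<and>
        (\<forall>k. w s $ k
           + (\<Sum>i\<in>UNIV. \<Sum>j\<in>UNIV. christoffel g (\<gamma> s) k i j * v s $ i * v s $ j) = 0))"

text \<open>No causal character is prescribed for the geodesic.\<close>

definition geodesically_connected ::
    "(real^'n \<Rightarrow> real^'n^'n) \<Rightarrow> (real^'n::finite) set \<Rightarrow> bool" where
  "geodesically_connected g M \<longleftrightarrow>
     (\<forall>p\<in>M. \<forall>q\<in>M. \<exists>\<gamma>. geodesic_on g M {0..1} \<gamma> \<and> \<gamma> 0 = p \<and> \<gamma> 1 = q)"

section \<open>Boyer--Lindquist coordinates\<close>

text \<open>
  The product of \<open>\<real>\<^sup>3\<close> and the time line is modelled by \<open>real^4\<close>: components 1, 2, 3 are the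
  Cartesian coordinates \<open>(x, y, z)\<close> on \<open>\<real>\<^sup>3\<close> and component 4 is \<open>t\<close>. Accordingly the
  Boyer--Lindquist coordinates \<open>(r, \<theta>, \<phi>, t)\<close> are numbered 1, 2, 3, 4.
\<close>

definition bl_r :: "real^4 \<Rightarrow> real" where
  "bl_r p = sqrt ((p$1)\<^sup>2 + (p$2)\<^sup>2 + (p$3)\<^sup>2)"

definition bl_theta :: "real^4 \<Rightarrow> real" where
  "bl_theta p = arccos (p$3 / bl_r p)"

definition off_axis :: "(real^4) set" where
  "off_axis = {p. (p$1)\<^sup>2 + (p$2)\<^sup>2 > 0}"

definition vec4 :: "'a \<Rightarrow> 'a \<Rightarrow> 'a \<Rightarrow> 'a \<Rightarrow> 'a^4" where
  "vec4 a b c d = (\<chi> i. if i = 1 then a else if i = 2 then b else if i = 3 then c else d)"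

lemma vec4_nth [simp]:
  "vec4 a b c d $ 1 = a" "vec4 a b c d $ 2 = b" "vec4 a b c d $ 3 = c" "vec4 a b c d $ 4 = d"
  by (simp_all add: vec4_def)

text \<open>
  The rows are the coordinate differentials \<open>dr\<close>, \<open>d\<theta>\<close>, \<open>d\<phi>\<close>, \<open>dt\<close> in Cartesian components;
  lemma \<open>bl_coframe_dual\<close> below confirms that this is the inverse Jacobian matrix of the
  spherical coordinate map.
\<close>

definition bl_coframe :: "real^4 \<Rightarrow> real^4^4" where
  "bl_coframe p =
     (let x = p$1; y = p$2; z = p$3; r = bl_r p; \<rho> = sqrt (x\<^sup>2 + y\<^sup>2) in
      vec4 (vec4 (x / r) (y / r) (z / r) 0)
           (vec4 (x * z / (r\<^sup>2 * \<rho>)) (y * z / (r\<^sup>2 * \<rho>)) (- \<rho> / r\<^sup>2) 0)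
           (vec4 (- y / \<rho>\<^sup>2) (x / \<rho>\<^sup>2) 0 0)
           (vec4 0 0 0 1))"

definition spherical :: "real^4 \<Rightarrow> real^4" where
  "spherical q = vec4 (q$1 * sin (q$2) * cos (q$3)) (q$1 * sin (q$2) * sin (q$3))
                      (q$1 * cos (q$2)) (q$4)"

definition spherical_jacobian :: "real^4 \<Rightarrow> real^4^4" where
  "spherical_jacobian q =
     vec4 (vec4 (sin (q$2) * cos (q$3)) (q$1 * cos (q$2) * cos (q$3)) (- q$1 * sin (q$2) * sin (q$3)) 0)
          (vec4 (sin (q$2) * sin (q$3)) (q$1 * cos (q$2) * sin (q$3)) (q$1 * sin (q$2) * cos (q$3)) 0)
          (vec4 (cos (q$2)) (- q$1 * sin (q$2)) 0 0)
          (vec4 0 0 0 1)"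

lemma spherical_has_derivative:
  "(spherical has_derivative (*v) (spherical_jacobian q)) (at q)"
proof -
  have nth: "((\<lambda>q. q $ k) has_derivative (\<lambda>h. h $ k)) (at q)" for k :: 4 and q :: "real^4"
    by (intro bounded_linear_imp_has_derivative bounded_linear_vec_nth)
  have "((\<lambda>q. spherical q $ k) has_derivative (\<lambda>h. (spherical_jacobian q *v h) $ k)) (at q)" for k
    using exhaust_4[of k]
    apply (elim disjE; clarsimp simp: spherical_def spherical_jacobian_def matrix_vector_mult_def sum_4)
       apply (auto intro!: derivative_eq_intros nth simp: algebra_simps)
    done
  then show ?thesis
    by (subst has_derivative_componentwise_within)
       (auto simp: Basis_vec_def inner_axis)
qed

lemma
  assumes "q$1 > 0" "0 < q$2" "q$2 < pi"
  shows bl_r_spherical: "bl_r (spherical q) = q$1"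
    and bl_theta_spherical: "bl_theta (spherical q) = q$2"
    and spherical_off_axis: "spherical q \<in> off_axis"
    and bl_coframe_dual: "bl_coframe (spherical q) ** spherical_jacobian q = mat 1"
proof -
  let ?R = "q$1" and ?S = "sin (q$2)" and ?C = "cos (q$2)" and ?s = "sin (q$3)" and ?c = "cos (q$3)"
  have s: "?S > 0"
    using assms by (simp add: sin_gt_zero)
  have e1: "?C * ?C = 1 - ?S * ?S" and e2: "?c * ?c = 1 - ?s * ?s"
    using sin_cos_squared_add[of "q$2"] sin_cos_squared_add[of "q$3"] by (simp_all add: power2_eq_square)
  have rho: "(?R * ?S * ?c)\<^sup>2 + (?R * ?S * ?s)\<^sup>2 = (?R * ?S)\<^sup>2"
    using sin_cos_squared_add[of "q$3"] by algebra
  have "(?R * ?S)\<^sup>2 + (?R * ?C)\<^sup>2 = ?R\<^sup>2"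
    using sin_cos_squared_add[of "q$2"] by algebra
  then show r: "bl_r (spherical q) = ?R"
    using assms by (simp add: bl_r_def spherical_def rho)
  show "bl_theta (spherical q) = q$2"
    using assms unfolding bl_theta_def r by (simp add: spherical_def arccos_cos)
  show "spherical q \<in> off_axis"
    using assms s by (simp add: off_axis_def spherical_def rho)
  have rs: "sqrt ((spherical q $ 1)\<^sup>2 + (spherical q $ 2)\<^sup>2) = ?R * ?S"
    using assms s by (simp add: spherical_def rho)
  have co: "bl_coframe (spherical q) =
      vec4 (vec4 (?S * ?c) (?S * ?s) ?C 0)
        (vec4 (?C * ?c / ?R) (?C * ?s / ?R) (- ?S / ?R) 0)
        (vec4 (- ?s / (?R * ?S)) (?c / (?R * ?S)) 0 0)
        (vec4 0 0 0 1)"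
    unfolding bl_coframe_def Let_def r rs using assms s
    by (simp add: spherical_def power2_eq_square field_simps)
  have "\<forall>i j. (\<Sum>k\<in>UNIV. bl_coframe (spherical q) $ i $ k * spherical_jacobian q $ k $ j)
      = (if i = j then 1 else 0)"
    unfolding co spherical_jacobian_def sum_4 forall_4
    using assms s by (simp add: field_simps) (use e1 e2 in \<open>intro conjI; algebra\<close>)
  then show "bl_coframe (spherical q) ** spherical_jacobian q = mat 1"
    by (simp add: vec_eq_iff matrix_matrix_mult_def mat_def)
qed

section \<open>The Kerr metric\<close>

definition kerr_lambda :: "real \<Rightarrow> real \<Rightarrow> real \<Rightarrow> real" where
  "kerr_lambda a r \<theta> = r\<^sup>2 + a\<^sup>2 * (cos \<theta>)\<^sup>2"

definition kerr_delta :: "real \<Rightarrow> real \<Rightarrow> real \<Rightarrow> real" where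
  "kerr_delta m a r = r\<^sup>2 - 2 * m * r + a\<^sup>2"

definition kerr_bl :: "real \<Rightarrow> real \<Rightarrow> real \<Rightarrow> real \<Rightarrow> real^4^4" where
  "kerr_bl m a r \<theta> =
     (let lam = kerr_lambda a r \<theta>;
          g11 = lam / kerr_delta m a r;
          g22 = lam;
          g33 = (r\<^sup>2 + a\<^sup>2 + 2 * m * r * a\<^sup>2 * (sin \<theta>)\<^sup>2 / lam) * (sin \<theta>)\<^sup>2;
          g34 = - (2 * m * r * a * (sin \<theta>)\<^sup>2 / lam);
          g44 = - 1 + 2 * m * r / lam
      in vec4 (vec4 g11 0 0 0)
              (vec4 0 g22 0 0)
              (vec4 0 0 g33 g34)
              (vec4 0 0 g34 g44))"

text \<open>
  Cartesian components of the Kerr metric: off the axis they are obtained from the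
  Boyer--Lindquist components, and the values on the axis are those of the continuous extension
  (which exists on the region considered, by lemmas \<open>kerr_metric_cartesian\<close> and
  \<open>kerr_region_regular\<close> below).
\<close>

definition kerr_off_axis :: "real \<Rightarrow> real \<Rightarrow> real^4 \<Rightarrow> real^4^4" where
  "kerr_off_axis m a p =
     transpose (bl_coframe p) ** kerr_bl m a (bl_r p) (bl_theta p) ** bl_coframe p"

definition kerr_metric :: "real \<Rightarrow> real \<Rightarrow> real^4 \<Rightarrow> real^4^4" where
  "kerr_metric m a p =
     (if p \<in> off_axis then kerr_off_axis m a p
      else Lim (at p within off_axis) (kerr_off_axis m a))"

definition kerr_region :: "real \<Rightarrow> real \<Rightarrow> (real^4) set" where
  "kerr_region m a =
     {p. bl_r p > m + sqrt (m\<^sup>2 - a\<^sup>2 * (cos (bl_theta p))\<^sup>2)}"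

text \<open>
  A closed form without singularity wherever \<open>r > 0\<close> and \<open>kerr_delta m a r \<noteq> 0\<close>, axis included;
  \<open>om\<close> is the form \<open>sin\<^sup>2 \<theta> d\<phi>\<close>.
\<close>

definition kerr_cartesian :: "real \<Rightarrow> real \<Rightarrow> real^4 \<Rightarrow> real^4^4" where
  "kerr_cartesian m a p =
     (let x = p$1; y = p$2; z = p$3; r = bl_r p;
          lam = r\<^sup>2 + a\<^sup>2 * (z / r)\<^sup>2;
          dr = vec4 (x / r) (y / r) (z / r) 0;
          om = vec4 (- y / r\<^sup>2) (x / r\<^sup>2) 0 0;
          dt = vec4 0 0 0 1
      in \<chi> i j. - (1 - 2 * m * r / lam) * dt$i * dt$j
              + lam / kerr_delta m a r * dr$i * dr$j
              + lam / r\<^sup>2 * ((if i = j \<and> i \<noteq> 4 then 1 else 0) - dr$i * dr$j)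
              + a\<^sup>2 * (1 + 2 * m * r / lam) * om$i * om$j
              - 2 * m * r * a / lam * (om$i * dt$j + dt$i * om$j))"

lemma kerr_off_axis_cartesian:
  assumes "p \<in> off_axis"
  shows "kerr_off_axis m a p = kerr_cartesian m a p"
proof -
  define x y z r \<rho> where "x = p$1" and "y = p$2" and "z = p$3" and "r = bl_r p"
    and "\<rho> = sqrt (x\<^sup>2 + y\<^sup>2)"
  note defs = x_def [symmetric] y_def [symmetric] z_def [symmetric] r_def [symmetric]
  have pos: "x\<^sup>2 + y\<^sup>2 > 0"
    using assms by (simp add: off_axis_def defs)
  have \<rho>: "\<rho> > 0" "\<rho>\<^sup>2 = x\<^sup>2 + y\<^sup>2"
    using pos by (simp_all add: \<rho>_def)
  have "x\<^sup>2 + y\<^sup>2 + z\<^sup>2 > 0"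
    using pos by (simp add: add_pos_nonneg)
  then have r: "r > 0" "r\<^sup>2 = x\<^sup>2 + y\<^sup>2 + z\<^sup>2"
    by (simp_all add: r_def bl_r_def x_def y_def z_def)
  then have "z\<^sup>2 \<le> r\<^sup>2"
    by simp
  then have "\<bar>z / r\<bar> \<le> 1"
    using r(1) abs_le_square_iff[of z r] by (simp add: abs_div divide_le_eq_1)
  then have c: "cos (bl_theta p) = z / r"
    by (simp add: bl_theta_def defs cos_arccos_abs)
  have s: "(sin (bl_theta p))\<^sup>2 = \<rho>\<^sup>2 / r\<^sup>2"
  proof -
    have "1 - (z / r)\<^sup>2 = (r\<^sup>2 - z\<^sup>2) / r\<^sup>2"
      using r(1) by (simp add: field_simps)
    then show ?thesis
      using r(2) \<rho>(2) by (simp add: sin_squared_eq c)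
  qed
  define L N K where "L = r\<^sup>2 + a\<^sup>2 * (z / r)\<^sup>2" and "N = 2 * m * r / L"
    and "K = L / kerr_delta m a r"
  have lam: "kerr_lambda a r (bl_theta p) = L"
    by (simp add: kerr_lambda_def c L_def)
  let ?dr = "vec4 (x / r) (y / r) (z / r) 0"
  let ?dth = "vec4 (x * z / (r\<^sup>2 * \<rho>)) (y * z / (r\<^sup>2 * \<rho>)) (- \<rho> / r\<^sup>2) 0"
  let ?om = "vec4 (- y / r\<^sup>2) (x / r\<^sup>2) 0 0"
  let ?dphi = "vec4 (- y / \<rho>\<^sup>2) (x / \<rho>\<^sup>2) 0 0"
  let ?dt = "vec4 0 0 0 1 :: real^4"
  have om: "\<rho>\<^sup>2 / r\<^sup>2 * ?dphi $ i = ?om $ i" for i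
    using exhaust_4[of i] \<rho>(1) r(1) by auto
  have "\<forall>i j. ?dth $ i * ?dth $ j = ((if i = j \<and> i \<noteq> 4 then 1 else 0) - ?dr $ i * ?dr $ j) / r\<^sup>2
      - \<rho>\<^sup>2 / r\<^sup>2 * (?dphi $ i * ?dphi $ j)"
    unfolding forall_4 using \<rho>(1) r(1)
    by (simp add: divide_simps) (use \<rho>(2) r(2) in \<open>intro conjI; algebra\<close>)
  then have dth: "?dth $ i * ?dth $ j = ((if i = j \<and> i \<noteq> 4 then 1 else 0) - ?dr $ i * ?dr $ j) / r\<^sup>2
      - \<rho>\<^sup>2 / r\<^sup>2 * (?dphi $ i * ?dphi $ j)" for i j
    by blast
  have "kerr_off_axis m a p $ i $ j = kerr_cartesian m a p $ i $ j" for i j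
  proof -
    have g33: "(r\<^sup>2 + a\<^sup>2 + N * a\<^sup>2 * (\<rho>\<^sup>2 / r\<^sup>2)) * (\<rho>\<^sup>2 / r\<^sup>2) =
        L * (\<rho>\<^sup>2 / r\<^sup>2) + a\<^sup>2 * (1 + N) * (\<rho>\<^sup>2 / r\<^sup>2)\<^sup>2"
    proof -
      have "r\<^sup>2 + a\<^sup>2 = L + a\<^sup>2 * (\<rho>\<^sup>2 / r\<^sup>2)"
        unfolding s [symmetric] L_def c [symmetric] by (simp add: sin_squared_eq algebra_simps)
      then show ?thesis
        by (simp add: algebra_simps power2_eq_square add_divide_distrib)
    qed
    have coframe: "bl_coframe p = vec4 ?dr ?dth ?dphi ?dt"
      by (simp add: bl_coframe_def Let_def defs \<rho>(2) \<rho>_def [symmetric])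
    have bl: "kerr_bl m a r (bl_theta p) = vec4 (vec4 K 0 0 0) (vec4 0 L 0 0)
        (vec4 0 0 (L * (\<rho>\<^sup>2 / r\<^sup>2) + a\<^sup>2 * (1 + N) * (\<rho>\<^sup>2 / r\<^sup>2)\<^sup>2) (- (N * a * (\<rho>\<^sup>2 / r\<^sup>2))))
        (vec4 0 0 (- (N * a * (\<rho>\<^sup>2 / r\<^sup>2))) (- 1 + N))"
      unfolding g33 [symmetric] by (simp add: kerr_bl_def Let_def lam s K_def N_def mult.commute)
    have congruence: "(transpose (vec4 u v w k) ** vec4 (vec4 A 0 0 0) (vec4 0 B 0 0) (vec4 0 0 G H)
          (vec4 0 0 H F) ** vec4 u v w k) $ i $ j
        = A * u$i * u$j + B * (v$i * v$j) + G * w$i * w$j + H * (w$i * k$j + k$i * w$j) + F * k$i * k$j"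
      for u v w k :: "real^4" and A B F G H :: real
      by (simp add: matrix_matrix_mult_def transpose_def sum_4 algebra_simps)
    have regroup: "A + L * (X - \<sigma> * (f * f')) + (L * \<sigma> + a\<^sup>2 * (1 + N) * \<sigma>\<^sup>2) * f * f'
          - N * a * \<sigma> * (f * t' + t * f') + B
        = A + L * X + a\<^sup>2 * (1 + N) * (\<sigma> * f) * (\<sigma> * f')
          - N * a * ((\<sigma> * f) * t' + t * (\<sigma> * f')) + B"
      for A B X \<sigma> f f' t t' :: real
      by (simp add: algebra_simps power2_eq_square)
    have "kerr_off_axis m a p $ i $ j =
        K * ?dr $ i * ?dr $ j + L * (?dth $ i * ?dth $ j)
        + (L * (\<rho>\<^sup>2 / r\<^sup>2) + a\<^sup>2 * (1 + N) * (\<rho>\<^sup>2 / r\<^sup>2)\<^sup>2) * ?dphi $ i * ?dphi $ j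
        - N * a * (\<rho>\<^sup>2 / r\<^sup>2) * (?dphi $ i * ?dt $ j + ?dt $ i * ?dphi $ j)
        + (- 1 + N) * ?dt $ i * ?dt $ j"
      unfolding kerr_off_axis_def defs coframe bl congruence by (simp add: algebra_simps)
    also have "\<dots> = K * ?dr $ i * ?dr $ j
        + L * (((if i = j \<and> i \<noteq> 4 then 1 else 0) - ?dr $ i * ?dr $ j) / r\<^sup>2)
        + a\<^sup>2 * (1 + N) * (\<rho>\<^sup>2 / r\<^sup>2 * ?dphi $ i) * (\<rho>\<^sup>2 / r\<^sup>2 * ?dphi $ j)
        - N * a * ((\<rho>\<^sup>2 / r\<^sup>2 * ?dphi $ i) * ?dt $ j + ?dt $ i * (\<rho>\<^sup>2 / r\<^sup>2 * ?dphi $ j))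
        + (- 1 + N) * ?dt $ i * ?dt $ j"
      unfolding dth by (rule regroup)
    also have "\<dots> = kerr_cartesian m a p $ i $ j"
      unfolding om
      by (simp add: kerr_cartesian_def Let_def defs K_def N_def L_def)
    finally show ?thesis .
  qed
  then show ?thesis
    by (simp add: vec_eq_iff)
qed

lemma kerr_metric_cartesian:
  assumes "bl_r p > 0" and "kerr_delta m a (bl_r p) \<noteq> 0"
  shows "kerr_metric m a p = kerr_cartesian m a p"
proof (cases "p \<in> off_axis")
  case True
  then show ?thesis
    by (simp add: kerr_metric_def kerr_off_axis_cartesian)
next
  case False
  then have ax: "p$1 = 0" "p$2 = 0"
    by (simp_all add: off_axis_def not_less sum_power2_le_zero_iff)
  have "p islimpt off_axis"
    unfolding islimpt_approachable
  proof (intro allI impI)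
    fix e :: real assume "e > 0"
    define q where "q = p + (e / 2) *\<^sub>R axis 1 1"
    have "q \<in> off_axis"
      using \<open>e > 0\<close> ax by (simp add: q_def off_axis_def add_pos_nonneg)
    moreover have "dist q p < e"
      using \<open>e > 0\<close> by (simp add: q_def dist_norm norm_axis_1)
    ultimately show "\<exists>q\<in>off_axis. q \<noteq> p \<and> dist q p < e"
      using False by metis
  qed
  then have nontriv: "at p within off_axis \<noteq> bot"
    by (simp add: trivial_limit_within)
  have lam: "(bl_r p)\<^sup>2 + a\<^sup>2 * (p$3 / bl_r p)\<^sup>2 \<noteq> 0"
    using assms(1) by (smt (verit) zero_less_power zero_le_mult_iff zero_le_power2)
  have r: "isCont bl_r p"
    unfolding bl_r_def by (intro continuous_intros)
  have "((\<lambda>q. kerr_cartesian m a q $ i $ j) \<longlongrightarrow> kerr_cartesian m a p $ i $ j) (at p)" for i j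
  proof -
    have "isCont (\<lambda>q. kerr_cartesian m a q $ i $ j) p"
      unfolding kerr_cartesian_def Let_def kerr_delta_def
      using exhaust_4[of i] exhaust_4[of j] assms lam
      by (elim disjE; simp add: kerr_delta_def; intro continuous_intros r; simp add: kerr_delta_def)
    then show ?thesis
      by (simp add: isCont_def)
  qed
  then have "(kerr_cartesian m a \<longlongrightarrow> kerr_cartesian m a p) (at p)"
    by (intro vec_tendstoI)
  then have "(kerr_cartesian m a \<longlongrightarrow> kerr_cartesian m a p) (at p within off_axis)"
    by (rule tendsto_within_subset) simp
  then have "(kerr_off_axis m a \<longlongrightarrow> kerr_cartesian m a p) (at p within off_axis)"
    by (rule Lim_transform_eventually)
       (simp add: eventually_at_topological kerr_off_axis_cartesian; blast)
  with nontriv have "Lim (at p within off_axis) (kerr_off_axis m a) = kerr_cartesian m a p"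
    by (rule tendsto_Lim)
  with False show ?thesis
    by (simp add: kerr_metric_def)
qed

lemma kerr_region_regular:
  assumes "m > 0" "p \<in> kerr_region m a" "a\<^sup>2 \<le> m\<^sup>2"
  shows "bl_r p > 0" and "kerr_delta m a (bl_r p) > 0"
proof -
  let ?r = "bl_r p"
  have "a\<^sup>2 * (cos (bl_theta p))\<^sup>2 \<le> a\<^sup>2"
    using abs_cos_le_one[of "bl_theta p"] by (simp add: mult_left_le abs_square_le_1)
  then have "sqrt (m\<^sup>2 - a\<^sup>2) \<le> sqrt (m\<^sup>2 - a\<^sup>2 * (cos (bl_theta p))\<^sup>2)"
    by simp
  then have *: "?r - m > sqrt (m\<^sup>2 - a\<^sup>2)"
    using assms(2) unfolding kerr_region_def mem_Collect_eq by linarith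
  moreover have "sqrt (m\<^sup>2 - a\<^sup>2) \<ge> 0"
    using assms by simp
  ultimately show "?r > 0"
    using assms by linarith
  have "(?r - m)\<^sup>2 > m\<^sup>2 - a\<^sup>2"
    using * by (metis real_sqrt_less_iff real_sqrt_abs abs_ge_self order_less_le_trans)
  then show "kerr_delta m a ?r > 0"
    by (simp add: kerr_delta_def power2_eq_square algebra_simps)
qed

lemma kerr_pullback:
  assumes "q$1 > 0" "0 < q$2" "q$2 < pi"
  shows "transpose (spherical_jacobian q) ** kerr_metric m a (spherical q) ** spherical_jacobian q
      = kerr_bl m a (q$1) (q$2)"
proof -
  note [simp] = bl_r_spherical[OF assms] bl_theta_spherical[OF assms] spherical_off_axis[OF assms]
  have "transpose (spherical_jacobian q) ** transpose (bl_coframe (spherical q)) = mat 1"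
    using bl_coframe_dual[OF assms] by (metis matrix_transpose_mul transpose_mat)
  then show ?thesis
    unfolding kerr_metric_def kerr_off_axis_def
    by (simp add: matrix_mul_assoc) (metis bl_coframe_dual[OF assms] matrix_mul_assoc matrix_mul_rid)
qed

end

theory Submission
  imports Defs
begin

text \<open>
  Take two points on opposite halves of the axis, at the same time \<open>t\<close> and with the same
  \<open>r < 2m\<close>; this is possible because the stationary limit surface meets the axis at
  \<open>r = m + sqrt (m\<^sup>2 - a\<^sup>2) < 2m\<close>. A geodesic starting on the axis has vanishing angular momentum,
  and then its energy is a positive multiple of the derivative of \<open>t\<close>, which vanishes somewhere
  by Rolle's theorem. So the energy is zero and the geodesic moves in the \<open>(r, \<theta>)\<close> surface with metric
  \<open>\<lambda> (dr\<^sup>2 / \<Delta> + d\<theta>\<^sup>2)\<close>. There the dilation \<open>r \<partial>/\<partial>r\<close> is expanding in the \<open>\<theta>\<close> direction, whence \<open>r\<close> has no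
  interior maximum along the geodesic. But the geodesic crosses the equatorial plane, where
  \<open>r > 2m\<close>, a contradiction.
\<close>

section \<open>Geodesics and momenta\<close>

lemma partial_deriv_cong:
  assumes "\<forall>\<^sub>F q in nhds p. f q = g q"
  shows "partial_deriv k f p = partial_deriv k g p"
  unfolding partial_deriv_def
proof (rule deriv_cong_ev)
  have "isCont (\<lambda>h. p + h *\<^sub>R axis k (1::real)) 0"
    by (intro continuous_intros)
  then have "((\<lambda>h. p + h *\<^sub>R axis k (1::real)) \<longlongrightarrow> p) (nhds 0)"
    using tendsto_at_iff_tendsto_nhds[of "\<lambda>h. p + h *\<^sub>R axis k (1::real)" 0] by (simp add: isCont_def)
  then show "\<forall>\<^sub>F h in nhds 0. f (p + h *\<^sub>R axis k 1) = g (p + h *\<^sub>R axis k 1)"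
    using assms by (rule eventually_compose_filterlim[rotated])
qed simp

lemma christoffel_cong:
  assumes "\<forall>\<^sub>F q in nhds p. g q = h q"
  shows "christoffel g p = christoffel h p"
proof -
  have "partial_deriv k (\<lambda>q. g q $ i $ j) p = partial_deriv k (\<lambda>q. h q $ i $ j) p" for k i j
    by (rule partial_deriv_cong) (use assms in \<open>auto elim: eventually_mono\<close>)
  then show ?thesis
    using eventually_nhds_x_imp_x[OF assms] by (intro ext) (simp add: christoffel_def)
qed

text \<open>Christoffel symbols involve derivatives of the metric, so agreement near each point of
  \<open>M\<close> is assumed. This lets a closed form stand in for \<open>kerr_metric\<close>,
  whose values on the axis are limits.\<close>

lemma geodesic_on_cong:
  assumes "\<And>p. p \<in> M \<Longrightarrow> \<forall>\<^sub>F q in nhds p. g q = h q"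
  shows "geodesic_on g M I \<gamma> \<longleftrightarrow> geodesic_on h M I \<gamma>"
proof -
  have "\<gamma> s \<in> M \<Longrightarrow> christoffel g (\<gamma> s) = christoffel h (\<gamma> s)" for s
    by (intro christoffel_cong assms)
  then show ?thesis
    unfolding geodesic_on_def by (intro conj_cong) auto
qed

lemma partial_deriv_component:
  fixes g :: "real^'n::finite \<Rightarrow> real^'n^'n"
  assumes "(g has_derivative G) (at p)"
  shows "partial_deriv k (\<lambda>q. g q $ i $ j) p = G (axis k 1) $ i $ j"
proof -
  interpret G: bounded_linear G
    using assms by (rule has_derivative_bounded_linear)
  have "((\<lambda>h. p + h *\<^sub>R axis k (1::real)) has_derivative (\<lambda>h. h *\<^sub>R axis k 1)) (at 0)"
    by (auto intro!: derivative_eq_intros)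
  then have "((\<lambda>h. g (p + h *\<^sub>R axis k 1)) has_derivative (\<lambda>h. G (h *\<^sub>R axis k 1))) (at 0)"
    by (rule has_derivative_compose) (use assms in simp)
  then have "((\<lambda>h. g (p + h *\<^sub>R axis k 1) $ i $ j) has_derivative
      (\<lambda>h. G (h *\<^sub>R axis k 1) $ i $ j)) (at 0)"
    by (intro bounded_linear.has_derivative[OF bounded_linear_vec_nth])
  then have "((\<lambda>h. g (p + h *\<^sub>R axis k 1) $ i $ j) has_real_derivative G (axis k 1) $ i $ j) (at 0)"
    by (simp add: has_field_derivative_def G.scaleR mult.commute[of _ "G (axis k 1) $ i $ j"])
  then show ?thesis
    unfolding partial_deriv_def by (rule DERIV_imp_deriv)
qed

text \<open>Lowering the free index with \<open>g p\<close> cancels the inverse matrix in the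
  Christoffel symbols. What remains involves only \<open>G\<close>, the derivative of the metric, so
  rates of change of momenta can be computed without ever inverting the metric.\<close>

lemma geodesic_equation_covariant:
  fixes g :: "real^'n::finite \<Rightarrow> real^'n^'n"
  assumes der: "(g has_derivative G) (at p)" and inv: "invertible (g p)"
    and eq: "\<And>k. w $ k + (\<Sum>i\<in>UNIV. \<Sum>j\<in>UNIV. christoffel g p k i j * v $ i * v $ j) = 0"
  shows "y \<bullet> (g p *v w) = v \<bullet> (G y *v v) / 2 - v \<bullet> (G v *v y)"
proof -
  interpret G: bounded_linear G
    using der by (rule has_derivative_bounded_linear)
  have G_expand: "G u $ i $ j = (\<Sum>k\<in>UNIV. u $ k * G (axis k 1) $ i $ j)" for u i j
  proof -
    have "u = (\<Sum>k\<in>UNIV. u $ k *\<^sub>R axis k 1)"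
      using basis_expansion[of u] by (simp add: scalar_mult_eq_scaleR)
    then have "G u = (\<Sum>k\<in>UNIV. u $ k *\<^sub>R G (axis k 1))"
      by (metis (no_types, lifting) G.scaleR G.sum sum.cong)
    then show ?thesis
      by simp
  qed
  define b where "b = (\<chi> l. (\<Sum>i\<in>UNIV. \<Sum>j\<in>UNIV. (G (axis i 1) $ j $ l + G (axis j 1) $ i $ l
      - G (axis l 1) $ i $ j) * v $ i * v $ j) / 2)"
  have "w = - (matrix_inv (g p) *v b)"
  proof (rule vec_eq_iff[THEN iffD2], rule allI)
    fix k
    have "(matrix_inv (g p) *v b) $ k =
      (\<Sum>l\<in>UNIV. \<Sum>i\<in>UNIV. \<Sum>j\<in>UNIV. matrix_inv (g p) $ k $ l *
        ((G (axis i 1) $ j $ l + G (axis j 1) $ i $ l - G (axis l 1) $ i $ j) * v $ i * v $ j) / 2)"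
      by (simp add: matrix_vector_mult_def b_def sum_distrib_left sum_divide_distrib)
    also have "\<dots> = (\<Sum>i\<in>UNIV. \<Sum>j\<in>UNIV. \<Sum>l\<in>UNIV. matrix_inv (g p) $ k $ l *
        ((G (axis i 1) $ j $ l + G (axis j 1) $ i $ l - G (axis l 1) $ i $ j) * v $ i * v $ j) / 2)"
      by (subst sum.swap, rule sum.cong[OF refl], rule sum.swap)
    also have "\<dots> = (\<Sum>i\<in>UNIV. \<Sum>j\<in>UNIV. christoffel g p k i j * v $ i * v $ j)"
      by (simp add: christoffel_def partial_deriv_component[OF der] sum_distrib_right
          sum_divide_distrib mult.assoc)
    finally show "w $ k = (- (matrix_inv (g p) *v b)) $ k"
      using eq[of k] by simp
  qed
  moreover have "g p ** matrix_inv (g p) = mat 1"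
    using inv unfolding invertible_def matrix_inv_def by (metis (mono_tags, lifting) someI_ex)
  ultimately have "g p *v w = - b"
    by (simp add: linear_neg[OF matrix_vector_mul_linear] matrix_vector_mul_assoc)
  then have "y \<bullet> (g p *v w) = - (\<Sum>l\<in>UNIV. y $ l * b $ l)"
    by (simp add: inner_vec_def sum_negf)
  also have "(\<Sum>l\<in>UNIV. y $ l * b $ l) = v \<bullet> (G v *v y) - v \<bullet> (G y *v v) / 2"
  proof -
    let ?D = "\<lambda>k i j. G (axis k 1) $ i $ j"
    have 1: "v \<bullet> (G v *v y) = (\<Sum>l\<in>UNIV. \<Sum>i\<in>UNIV. \<Sum>j\<in>UNIV. y $ l * ?D i j l * v $ i * v $ j)"
    proof -
      have "v \<bullet> (G v *v y) = (\<Sum>j\<in>UNIV. \<Sum>l\<in>UNIV. \<Sum>i\<in>UNIV. y $ l * ?D i j l * v $ i * v $ j)"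
        by (simp add: inner_vec_def matrix_vector_mult_def G_expand[of v] sum_distrib_left
            sum_distrib_right algebra_simps)
      also have "\<dots> = (\<Sum>l\<in>UNIV. \<Sum>i\<in>UNIV. \<Sum>j\<in>UNIV. y $ l * ?D i j l * v $ i * v $ j)"
        by (subst sum.swap, rule sum.cong[OF refl], rule sum.swap)
      finally show ?thesis .
    qed
    have 2: "v \<bullet> (G v *v y) = (\<Sum>l\<in>UNIV. \<Sum>i\<in>UNIV. \<Sum>j\<in>UNIV. y $ l * ?D j i l * v $ i * v $ j)"
      unfolding 1 by (rule sum.cong[OF refl], subst sum.swap) (simp add: algebra_simps)
    have 3: "v \<bullet> (G y *v v) = (\<Sum>l\<in>UNIV. \<Sum>i\<in>UNIV. \<Sum>j\<in>UNIV. y $ l * ?D l i j * v $ i * v $ j)"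
    proof -
      have "v \<bullet> (G y *v v) = (\<Sum>i\<in>UNIV. \<Sum>j\<in>UNIV. \<Sum>l\<in>UNIV. y $ l * ?D l i j * v $ i * v $ j)"
        by (simp add: inner_vec_def matrix_vector_mult_def G_expand[of y] sum_distrib_left
            sum_distrib_right algebra_simps)
      also have "\<dots> = (\<Sum>i\<in>UNIV. \<Sum>l\<in>UNIV. \<Sum>j\<in>UNIV. y $ l * ?D l i j * v $ i * v $ j)"
        by (rule sum.cong[OF refl], rule sum.swap)
      also have "\<dots> = (\<Sum>l\<in>UNIV. \<Sum>i\<in>UNIV. \<Sum>j\<in>UNIV. y $ l * ?D l i j * v $ i * v $ j)"
        by (rule sum.swap)
      finally show ?thesis .
    qed
    \<comment> \<open>Expansions 1 and 2 are the same number with \<open>i\<close> and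
      \<open>j\<close> interchanged. Each matches one of the first two derivative terms in
      \<open>b\<close>, which is why the same quantity is expanded in two ways.\<close>
    have "2 * (\<Sum>l\<in>UNIV. y $ l * b $ l) = v \<bullet> (G v *v y) + v \<bullet> (G v *v y) - v \<bullet> (G y *v v)"
      unfolding 3 by (subst 1, subst 2)
        (simp add: b_def sum_distrib_left sum_divide_distrib flip: sum.distrib sum_subtractf,
         simp add: algebra_simps)
    then show ?thesis
      by simp
  qed
  finally show ?thesis
    by simp
qed

section \<open>Rates of change of momenta and of the squared speed\<close>

lemma inner_matrix_symmetric:
  fixes A :: "real^'n::finite^'n"
  assumes "transpose A = A"
  shows "x \<bullet> (A *v y) = y \<bullet> (A *v x)"
  by (metis assms dot_lmul_matrix inner_commute vector_transpose_matrix)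

lemma has_derivative_matrix_form:
  fixes A :: "'a::real_normed_vector \<Rightarrow> real^'n::finite^'n"
  assumes "(x has_derivative x') (at s within I)" "(y has_derivative y') (at s within I)"
    "(A has_derivative A') (at s within I)"
  shows "((\<lambda>s. x s \<bullet> (A s *v y s)) has_derivative
    (\<lambda>h. x' h \<bullet> (A s *v y s) + x s \<bullet> (A' h *v y s) + x s \<bullet> (A s *v y' h))) (at s within I)"
proof -
  have 1: "((\<lambda>s. x s $ i) has_derivative (\<lambda>h. x' h $ i)) (at s within I)"
    "((\<lambda>s. y s $ i) has_derivative (\<lambda>h. y' h $ i)) (at s within I)"
    "((\<lambda>s. A s $ i $ j) has_derivative (\<lambda>h. A' h $ i $ j)) (at s within I)" for i j
    by (intro bounded_linear.has_derivative[OF bounded_linear_vec_nth] assms)+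
  show ?thesis
    unfolding inner_vec_def matrix_vector_mult_def
    by (auto intro!: derivative_eq_intros 1
        simp: fun_eq_iff sum_distrib_left sum.distrib algebra_simps)
qed

text \<open>
  Noether's theorem in the form in which the vector field need not be Killing: the momentum
  along \<open>y\<close> varies at half the rate at which the flow of \<open>y\<close>, followed here by the curve \<open>c\<close>
  and its tangent lift \<open>u\<close>, changes the metric.
\<close>

lemma geodesic_momentum:
  fixes g :: "real^'n::finite \<Rightarrow> real^'n^'n"
  assumes der: "(g has_derivative G) (at (\<gamma> s))"
    and inv: "invertible (g (\<gamma> s))" and sym: "transpose (g (\<gamma> s)) = g (\<gamma> s)"
    and \<gamma>: "(\<gamma> has_vector_derivative v s) (at s within I)"
    and v: "(v has_vector_derivative w) (at s within I)"
    and eq: "\<And>k. w $ k + (\<Sum>i\<in>UNIV. \<Sum>j\<in>UNIV. christoffel g (\<gamma> s) k i j * v s $ i * v s $ j) = 0"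
    and y: "(y has_vector_derivative y') (at s within I)"
    and c: "(c has_vector_derivative y s) (at 0)" "c 0 = \<gamma> s"
    and u: "(u has_vector_derivative y') (at 0)" "u 0 = v s"
    and D: "((\<lambda>h. u h \<bullet> (g (c h) *v u h)) has_real_derivative D) (at 0)"
  shows "((\<lambda>s. v s \<bullet> (g (\<gamma> s) *v y s)) has_real_derivative D / 2) (at s within I)"
proof -
  interpret G: bounded_linear G
    using der by (rule has_derivative_bounded_linear)
  note sym_form = inner_matrix_symmetric[OF sym]
  have "((\<lambda>s. g (\<gamma> s)) has_derivative (\<lambda>h. G (h *\<^sub>R v s))) (at s within I)"
    using \<gamma> der unfolding has_vector_derivative_def
    by (rule has_derivative_compose)
  from has_derivative_matrix_form[OF v[unfolded has_vector_derivative_def]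
      y[unfolded has_vector_derivative_def] this]
  have P: "((\<lambda>s. v s \<bullet> (g (\<gamma> s) *v y s)) has_real_derivative
      (w \<bullet> (g (\<gamma> s) *v y s) + v s \<bullet> (G (v s) *v y s) + v s \<bullet> (g (\<gamma> s) *v y'))) (at s within I)"
    by (rule has_derivative_imp_has_field_derivative)
       (simp add: G.scaleR scaleR_matrix_vector_assoc[symmetric] matrix_vector_mult_scaleR algebra_simps)
  have "((\<lambda>h. g (c h)) has_derivative (\<lambda>h. G (h *\<^sub>R y s))) (at 0)"
    using c der unfolding has_vector_derivative_def
    by (metis has_derivative_compose)
  from has_derivative_matrix_form[OF u(1)[unfolded has_vector_derivative_def]
      u(1)[unfolded has_vector_derivative_def] this]
  have "((\<lambda>h. u h \<bullet> (g (c h) *v u h)) has_real_derivative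
      (y' \<bullet> (g (\<gamma> s) *v v s) + v s \<bullet> (G (y s) *v v s) + v s \<bullet> (g (\<gamma> s) *v y'))) (at 0)"
    by (rule has_derivative_imp_has_field_derivative)
       (simp add: G.scaleR scaleR_matrix_vector_assoc[symmetric] matrix_vector_mult_scaleR
          c u algebra_simps)
  \<comment> \<open>Uniqueness of derivatives identifies \<open>D\<close> with the product-rule
    expression. Only the first-order data of \<open>c\<close> and \<open>u\<close> at 0 enter, so
    \<open>c\<close> need not be a genuine flow line.\<close>
  then have "D = y' \<bullet> (g (\<gamma> s) *v v s) + v s \<bullet> (G (y s) *v v s) + v s \<bullet> (g (\<gamma> s) *v y')"
    using D DERIV_unique by blast
  moreover have "w \<bullet> (g (\<gamma> s) *v y s) = v s \<bullet> (G (y s) *v v s) / 2 - v s \<bullet> (G (v s) *v y s)"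
    using geodesic_equation_covariant[OF der inv eq, of "y s"] sym_form[of w] by simp
  ultimately have "w \<bullet> (g (\<gamma> s) *v y s) + v s \<bullet> (G (v s) *v y s) + v s \<bullet> (g (\<gamma> s) *v y') = D / 2"
    using sym_form[of y' "v s"] by simp
  with P show ?thesis
    by simp
qed

text \<open>With \<open>y = v\<close> the covariant equation gives minus one half of the metric
  derivative term. The acceleration enters the product rule twice, equally by symmetry, and so
  cancels that term.\<close>

lemma geodesic_energy:
  fixes g :: "real^'n::finite \<Rightarrow> real^'n^'n"
  assumes der: "(g has_derivative G) (at (\<gamma> s))"
    and inv: "invertible (g (\<gamma> s))" and sym: "transpose (g (\<gamma> s)) = g (\<gamma> s)"
    and \<gamma>: "(\<gamma> has_vector_derivative v s) (at s within I)"
    and v: "(v has_vector_derivative w) (at s within I)"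
    and eq: "\<And>k. w $ k + (\<Sum>i\<in>UNIV. \<Sum>j\<in>UNIV. christoffel g (\<gamma> s) k i j * v s $ i * v s $ j) = 0"
  shows "((\<lambda>s. v s \<bullet> (g (\<gamma> s) *v v s)) has_real_derivative 0) (at s within I)"
proof -
  interpret G: bounded_linear G
    using der by (rule has_derivative_bounded_linear)
  have "((\<lambda>s. g (\<gamma> s)) has_derivative (\<lambda>h. G (h *\<^sub>R v s))) (at s within I)"
    using \<gamma> der unfolding has_vector_derivative_def
    by (rule has_derivative_compose)
  from has_derivative_matrix_form[OF v[unfolded has_vector_derivative_def]
      v[unfolded has_vector_derivative_def] this]
  have "((\<lambda>s. v s \<bullet> (g (\<gamma> s) *v v s)) has_real_derivative
      (w \<bullet> (g (\<gamma> s) *v v s) + v s \<bullet> (G (v s) *v v s) + v s \<bullet> (g (\<gamma> s) *v w))) (at s within I)"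
    by (rule has_derivative_imp_has_field_derivative)
       (simp add: G.scaleR scaleR_matrix_vector_assoc[symmetric] matrix_vector_mult_scaleR algebra_simps)
  moreover have "v s \<bullet> (g (\<gamma> s) *v w) = - (v s \<bullet> (G (v s) *v v s)) / 2"
    using geodesic_equation_covariant[OF der inv eq] by simp
  ultimately show ?thesis
    using inner_matrix_symmetric[OF sym, of w "v s"] by simp
qed

section \<open>The Kerr metric as a quadratic form\<close>

definition radial_form :: "real^4 \<Rightarrow> real^4 \<Rightarrow> real" where
  "radial_form p v = (p$1 * v$1 + p$2 * v$2 + p$3 * v$3) / bl_r p"

text \<open>This is sin^2 theta dphi, which extends smoothly by zero across the axis, where dphi
  itself is undefined.\<close>

definition axial_form :: "real^4 \<Rightarrow> real^4 \<Rightarrow> real" where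
  "axial_form p v = (p$1 * v$2 - p$2 * v$1) / (bl_r p)\<^sup>2"

definition spatial_inner :: "real^4 \<Rightarrow> real^4 \<Rightarrow> real" where
  "spatial_inner v u = v$1 * u$1 + v$2 * u$2 + v$3 * u$3"

definition bl_lambda :: "real \<Rightarrow> real^4 \<Rightarrow> real" where
  "bl_lambda a p = (bl_r p)\<^sup>2 + a\<^sup>2 * (p$3 / bl_r p)\<^sup>2"

text \<open>Later computations with the metric go through these few scalars instead of matrix
  entries. The difference of \<open>spatial_inner\<close> and the radial product is the Euclidean
  metric tangent to the spheres of constant r.\<close>

lemma kerr_cartesian_form:
  "v \<bullet> (kerr_cartesian m a p *v u) =
     - (1 - 2 * m * bl_r p / bl_lambda a p) * v$4 * u$4
     + bl_lambda a p / kerr_delta m a (bl_r p) * radial_form p v * radial_form p u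
     + bl_lambda a p / (bl_r p)\<^sup>2 * (spatial_inner v u - radial_form p v * radial_form p u)
     + a\<^sup>2 * (1 + 2 * m * bl_r p / bl_lambda a p) * axial_form p v * axial_form p u
     - 2 * m * bl_r p * a / bl_lambda a p * (axial_form p v * u$4 + v$4 * axial_form p u)"
proof -
  have expand: "v \<bullet> ((\<chi> i j. - A * vec4 0 0 0 1$i * vec4 0 0 0 1$j
        + B * vec4 d1 d2 d3 0$i * vec4 d1 d2 d3 0$j
        + C * ((if i = j \<and> i \<noteq> 4 then 1 else 0) - vec4 d1 d2 d3 0$i * vec4 d1 d2 d3 0$j)
        + D * vec4 o1 o2 0 0$i * vec4 o1 o2 0 0$j
        - F * (vec4 o1 o2 0 0$i * vec4 0 0 0 1$j + vec4 0 0 0 1$i * vec4 o1 o2 0 0$j)) *v u)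
     = - A * v$4 * u$4 + B * (d1 * v$1 + d2 * v$2 + d3 * v$3) * (d1 * u$1 + d2 * u$2 + d3 * u$3)
        + C * (v$1 * u$1 + v$2 * u$2 + v$3 * u$3
               - (d1 * v$1 + d2 * v$2 + d3 * v$3) * (d1 * u$1 + d2 * u$2 + d3 * u$3))
        + D * (o1 * v$1 + o2 * v$2) * (o1 * u$1 + o2 * u$2)
        - F * ((o1 * v$1 + o2 * v$2) * u$4 + v$4 * (o1 * u$1 + o2 * u$2))"
    for A B C D F d1 d2 d3 o1 o2 :: real
    by (simp add: inner_vec_def matrix_vector_mult_def sum_4 algebra_simps)
  have forms: "radial_form p w = p$1 / bl_r p * w$1 + p$2 / bl_r p * w$2 + p$3 / bl_r p * w$3"
    "axial_form p w = - p$2 / (bl_r p)\<^sup>2 * w$1 + p$1 / (bl_r p)\<^sup>2 * w$2" for w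
    by (simp_all add: radial_form_def axial_form_def add_divide_distrib diff_divide_distrib)
  show ?thesis
    unfolding kerr_cartesian_def Let_def expand forms bl_lambda_def spatial_inner_def by simp
qed

lemma transpose_kerr_cartesian: "transpose (kerr_cartesian m a p) = kerr_cartesian m a p"
  by (auto simp: transpose_def kerr_cartesian_def Let_def vec_eq_iff algebra_simps)

lemma differentiable_vec:
  fixes f :: "'a::real_normed_vector \<Rightarrow> 'b::euclidean_space^'n::finite"
  assumes "\<And>i. (\<lambda>x. f x $ i) differentiable at x within S"
  shows "f differentiable at x within S"
proof -
  obtain f' where f': "\<And>i. ((\<lambda>x. f x $ i) has_derivative f' i) (at x within S)"
    using assms unfolding differentiable_def by metis
  have "(f has_derivative (\<lambda>h. \<chi> i. f' i h)) (at x within S)"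
    by (subst has_derivative_componentwise_within)
      (auto simp: Basis_vec_def inner_axis intro!: has_derivative_inner_left f')
  then show ?thesis
    by (auto simp: differentiable_def)
qed

lemma bl_r_square: "(bl_r p)\<^sup>2 = (p$1)\<^sup>2 + (p$2)\<^sup>2 + (p$3)\<^sup>2"
  by (simp add: bl_r_def)

lemma differentiable_kerr_cartesian:
  assumes "bl_r p > 0" "kerr_delta m a (bl_r p) \<noteq> 0"
  shows "kerr_cartesian m a differentiable (at p)"
proof (intro differentiable_vec)
  fix i j
  have nth: "(\<lambda>q::real^4. q $ k) differentiable (at p)" for k
    by (intro bounded_linear_imp_differentiable bounded_linear_vec_nth)
  have "(sqrt \<circ> (\<lambda>q. (q$1)\<^sup>2 + (q$2)\<^sup>2 + (q$3)\<^sup>2)) differentiable (at p)"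
    using assms(1)
    by (intro differentiable_chain_at differentiable_add differentiable_power nth)
      (auto simp: bl_r_def intro!: real_differentiable_def[THEN iffD2] DERIV_real_sqrt)
  then have r: "bl_r differentiable (at p)"
    by (simp add: bl_r_def[abs_def] o_def)
  have lam: "(bl_r p)\<^sup>2 + a\<^sup>2 * (p$3 / bl_r p)\<^sup>2 \<noteq> 0"
    using assms(1) by (smt (verit) zero_less_power zero_le_mult_iff zero_le_power2)
  show "(\<lambda>q. kerr_cartesian m a q $ i $ j) differentiable (at p)"
    unfolding kerr_cartesian_def Let_def kerr_delta_def
    using exhaust_4[of i] exhaust_4[of j] assms lam
    by (elim disjE; simp add: kerr_delta_def; intro derivative_intros differentiable_divide r nth; 
        simp add: kerr_delta_def)
qed

text \<open>This is the positivity of beta = 1 - 2mr/lambda. It comes from lambda - 2mr = (r - m)^2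
  - (m^2 - a^2 cos^2 theta) after squaring the inequality that defines the region.\<close>

lemma kerr_region_lambda:
  assumes "m > 0" "p \<in> kerr_region m a" "a\<^sup>2 \<le> m\<^sup>2"
  shows "bl_lambda a p > 2 * m * bl_r p"
proof -
  have r: "bl_r p > 0"
    using kerr_region_regular[OF assms] by simp
  have "(p$3)\<^sup>2 \<le> (bl_r p)\<^sup>2"
    by (simp add: bl_r_square)
  then have "\<bar>p$3 / bl_r p\<bar> \<le> 1"
    using r abs_le_square_iff[of "p$3" "bl_r p"] by (simp add: abs_div divide_le_eq_1)
  then have c: "cos (bl_theta p) = p$3 / bl_r p"
    by (simp add: bl_theta_def cos_arccos_abs)
  have "sqrt (m\<^sup>2 - a\<^sup>2 * (p$3 / bl_r p)\<^sup>2) < bl_r p - m"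
    using assms(2) by (simp add: kerr_region_def c)
  \<comment> \<open>\<open>sqrt\<close> is negative at negative arguments, so the radicand must
    first be seen to be nonnegative; this is where \<open>a\<^sup>2 \<le> m\<^sup>2\<close>
    enters.\<close>
  moreover have "bl_r p - m > 0"
  proof -
    have "a\<^sup>2 * (p$3 / bl_r p)\<^sup>2 \<le> m\<^sup>2"
      using \<open>\<bar>p$3 / bl_r p\<bar> \<le> 1\<close> assms(3)
      by (metis abs_square_le_1 mult_left_le order_trans zero_le_power2)
    with calculation show ?thesis
      by (smt (verit) real_sqrt_ge_zero)
  qed
  ultimately have "m\<^sup>2 - a\<^sup>2 * (p$3 / bl_r p)\<^sup>2 < (bl_r p - m)\<^sup>2"
    by (metis less_eq_real_def real_sqrt_less_iff real_sqrt_unique)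
  then show ?thesis
    by (simp add: bl_lambda_def power2_eq_square algebra_simps)
qed

text \<open>By Lagrange's identity the defect is the squared length of a cross product, divided by
  r^2; for \<open>bl_r p = 0\<close> division by zero makes the left side 0. This makes the angular
  part of the metric nonnegative.\<close>

lemma radial_form_Cauchy_Schwarz: "(radial_form p v)\<^sup>2 \<le> spatial_inner v v"
proof (cases "bl_r p = 0")
  case False
  have "spatial_inner v v * (bl_r p)\<^sup>2 - (p$1 * v$1 + p$2 * v$2 + p$3 * v$3)\<^sup>2 =
    (p$1 * v$2 - p$2 * v$1)\<^sup>2 + (p$1 * v$3 - p$3 * v$1)\<^sup>2 + (p$2 * v$3 - p$3 * v$2)\<^sup>2"
    unfolding spatial_inner_def bl_r_square by algebra
  moreover have "\<dots> \<ge> 0"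
    by simp
  ultimately have "(p$1 * v$1 + p$2 * v$2 + p$3 * v$3)\<^sup>2 \<le> spatial_inner v v * (bl_r p)\<^sup>2"
    by linarith
  then show ?thesis
    using False by (simp add: radial_form_def power_divide divide_le_eq)
qed (simp add: radial_form_def spatial_inner_def)

section \<open>Vanishing angular momentum and nondegeneracy\<close>

definition rotation_field :: "real^4 \<Rightarrow> real^4" where
  "rotation_field p = vec4 (- p$2) (p$1) 0 0"

definition dilation_field :: "real^4 \<Rightarrow> real^4" where
  "dilation_field p = vec4 (p$1) (p$2) (p$3) 0"

text \<open>Vanishing angular momentum expresses the axial component through \<open>v$4\<close>.
  Substituting this into the energy leaves a multiple of \<open>v$4\<close>, whose factor is, off
  the axis, beta + g34^2/g33 up to sign.\<close>

lemma zero_angular_momentum_energy: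
  assumes "m > 0" "p \<in> kerr_region m a" "a\<^sup>2 \<le> m\<^sup>2"
    and L: "v \<bullet> (kerr_cartesian m a p *v rotation_field p) = 0"
  obtains b where "b > 0" "v \<bullet> (kerr_cartesian m a p *v axis 4 1) = - b * v$4"
    "v$4 = 0 \<Longrightarrow> axial_form p v = 0"
proof -
  \<comment> \<open>\<open>s\<close> is sin^2 theta, and \<open>N\<close> is 1 - beta, so that 0 <=
    \<open>N\<close> < 1 in the region.\<close>
  define r N s where "r = bl_r p" and "N = 2 * m * bl_r p / bl_lambda a p"
    and "s = axial_form p (rotation_field p)"
  have r: "r > 0"
    using kerr_region_regular[OF assms(1-3)] by (simp add: r_def)
  have lam: "bl_lambda a p > 2 * m * r"
    using kerr_region_lambda[OF assms(1-3)] by (simp add: r_def)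
  have lam0: "bl_lambda a p > 0"
    using assms(1) r lam by (smt (verit) mult_pos_pos)
  have N: "0 \<le> N" "N < 1"
    using assms(1) r lam lam0 by (simp_all add: N_def r_def)
  have s: "s \<ge> 0"
    by (simp add: s_def axial_form_def rotation_field_def)
  have Y: "radial_form p (rotation_field p) = 0" "rotation_field p $ 4 = 0"
    "spatial_inner v (rotation_field p) = r\<^sup>2 * axial_form p v"
    using r by (simp_all add: rotation_field_def radial_form_def axial_form_def r_def spatial_inner_def)
  have T: "radial_form p (axis 4 1) = 0" "axial_form p (axis 4 1) = 0" "spatial_inner v (axis 4 1) = 0"
    "(axis 4 1 :: real^4) $ 4 = 1"
    by (simp_all add: radial_form_def axial_form_def spatial_inner_def axis_def)
  \<comment> \<open>Off the axis this is g33 / sin^2 theta. Unlike g33 it stays positive on the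
    axis, so dividing by it covers both cases at once.\<close>
  define K where "K = bl_lambda a p + a\<^sup>2 * (1 + N) * s"
  have K: "K > 0"
    using lam0 N s by (simp add: K_def add_pos_nonneg)
  have "v \<bullet> (kerr_cartesian m a p *v rotation_field p) = K * axial_form p v - N * a * v$4 * s"
    unfolding kerr_cartesian_form Y s_def[symmetric] r_def[symmetric]
    using r by (simp add: K_def N_def r_def algebra_simps)
  then have om: "axial_form p v = N * a * s * v$4 / K"
    using L K by (simp add: field_simps)
  have "v \<bullet> (kerr_cartesian m a p *v axis 4 1) = - (1 - N) * v$4 - N * a * axial_form p v"
    unfolding kerr_cartesian_form T by (simp add: N_def)
  also have "\<dots> = - (1 - N + N\<^sup>2 * a\<^sup>2 * s / K) * v$4"
    unfolding om by (simp add: power2_eq_square algebra_simps)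
  finally have "v \<bullet> (kerr_cartesian m a p *v axis 4 1) = - (1 - N + N\<^sup>2 * a\<^sup>2 * s / K) * v$4" .
  moreover have "1 - N + N\<^sup>2 * a\<^sup>2 * s / K > 0"
    using N s K by (intro add_pos_nonneg) simp_all
  ultimately show ?thesis
    by (intro that[of "1 - N + N\<^sup>2 * a\<^sup>2 * s / K"]) (simp_all add: om)
qed

text \<open>Once the dt and axial components vanish, the form is a sum of a radial and an angular
  square with positive weights, hence positive definite on such vectors.\<close>

lemma kerr_form_zero_imp_zero:
  assumes "bl_r p > 0" "kerr_delta m a (bl_r p) > 0"
    and v: "v$4 = 0" "axial_form p v = 0" "v \<bullet> (kerr_cartesian m a p *v v) = 0"
  shows "v = 0"
proof -
  have lam0: "bl_lambda a p > 0"
    using assms(1) by (simp add: bl_lambda_def add_pos_nonneg)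
  have "bl_lambda a p / kerr_delta m a (bl_r p) * (radial_form p v)\<^sup>2
      + bl_lambda a p / (bl_r p)\<^sup>2 * (spatial_inner v v - (radial_form p v)\<^sup>2) = 0"
    using v unfolding kerr_cartesian_form by (simp add: power2_eq_square)
  moreover have "bl_lambda a p / kerr_delta m a (bl_r p) * (radial_form p v)\<^sup>2 \<ge> 0"
    "bl_lambda a p / (bl_r p)\<^sup>2 * (spatial_inner v v - (radial_form p v)\<^sup>2) \<ge> 0"
    using assms(1,2) lam0 radial_form_Cauchy_Schwarz[of p v] by simp_all
  ultimately have "bl_lambda a p / kerr_delta m a (bl_r p) * (radial_form p v)\<^sup>2 = 0"
    "bl_lambda a p / (bl_r p)\<^sup>2 * (spatial_inner v v - (radial_form p v)\<^sup>2) = 0"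
    by linarith+
  then have "spatial_inner v v = 0"
    using assms(1,2) lam0 by simp
  then have "v$1 = 0 \<and> v$2 = 0 \<and> v$3 = 0"
    unfolding spatial_inner_def by (smt (verit) zero_le_square mult_eq_0_iff)
  then show ?thesis
    using v(1) by (simp add: vec_eq_iff forall_4)
qed

text \<open>A kernel vector pairs to zero with the rotation field, with \<open>axis 4 1\<close> and
  with itself. Its angular momentum, energy and square therefore vanish, and the two preceding
  lemmas make it zero; no determinant is computed.\<close>

lemma invertible_kerr_cartesian:
  assumes "m > 0" "p \<in> kerr_region m a" "a\<^sup>2 \<le> m\<^sup>2"
  shows "invertible (kerr_cartesian m a p)"
proof -
  have "v = 0" if "kerr_cartesian m a p *v v = 0" for v
  proof -
    have 0: "v \<bullet> (kerr_cartesian m a p *v u) = 0" for u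
      by (metis dot_lmul_matrix inner_zero_left that transpose_kerr_cartesian vector_transpose_matrix)
    obtain b where "b > 0" "v \<bullet> (kerr_cartesian m a p *v axis 4 1) = - b * v$4"
      "v$4 = 0 \<Longrightarrow> axial_form p v = 0"
      using zero_angular_momentum_energy[OF assms 0] by blast
    with 0 show ?thesis
      by (intro kerr_form_zero_imp_zero[OF kerr_region_regular[OF assms]]) auto
  qed
  then show ?thesis
    by (metis invertible_left_inverse matrix_left_invertible_ker)
qed

text \<open>The neighbourhood is the open set where r and Delta are positive; the closed form is
  valid on it, axis points included.\<close>

lemma kerr_metric_eventually_cartesian:
  assumes "m > 0" "p \<in> kerr_region m a" "a\<^sup>2 \<le> m\<^sup>2"
  shows "\<forall>\<^sub>F q in nhds p. kerr_metric m a q = kerr_cartesian m a q"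
proof -
  have "open {q. bl_r q > 0 \<and> kerr_delta m a (bl_r q) > 0}"
    unfolding bl_r_def kerr_delta_def
    by (intro open_Collect_conj open_Collect_less continuous_intros)
  then show ?thesis
    using kerr_region_regular[OF assms]
    by (intro eventually_nhds[THEN iffD2] exI[of _ "{q. bl_r q > 0 \<and> kerr_delta m a (bl_r q) > 0}"])
       (auto intro: kerr_metric_cartesian)
qed

section \<open>Rotations, time translations and dilations acting on the metric\<close>

lemma has_vector_derivative_vec:
  fixes f :: "real \<Rightarrow> real^'n::finite"
  assumes "\<And>i. ((\<lambda>s. f s $ i) has_real_derivative d $ i) (at s within I)"
  shows "(f has_vector_derivative d) (at s within I)"
proof -
  have "((\<lambda>s. f s $ i) has_derivative (\<lambda>h. h * d $ i)) (at s within I)" for i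
    by (rule has_derivative_eq_rhs[OF assms[unfolded has_field_derivative_def]]) (simp add: fun_eq_iff)
  then show ?thesis
    unfolding has_vector_derivative_def
    by (subst has_derivative_componentwise_within) (auto simp: Basis_vec_def inner_axis)
qed

lemma has_real_derivative_component:
  fixes f :: "real \<Rightarrow> real^'n::finite"
  assumes "(f has_vector_derivative d) (at s within I)"
  shows "((\<lambda>s. f s $ i) has_real_derivative d $ i) (at s within I)"
  using bounded_linear.has_vector_derivative[OF bounded_linear_vec_nth assms]
  by (simp add: has_real_derivative_iff_has_vector_derivative)

lemma bounded_linear_rotation_field: "bounded_linear rotation_field"
  unfolding linear_conv_bounded_linear[symmetric]
  by (rule linearI) (simp_all add: rotation_field_def vec_eq_iff forall_4)

lemma bounded_linear_dilation_field: "bounded_linear dilation_field"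
  unfolding linear_conv_bounded_linear[symmetric]
  by (rule linearI) (simp_all add: dilation_field_def vec_eq_iff forall_4 distrib_left)

definition axial_rotation :: "real \<Rightarrow> real^4 \<Rightarrow> real^4" where
  "axial_rotation h p = vec4 (cos h * p$1 - sin h * p$2) (sin h * p$1 + cos h * p$2) (p$3) (p$4)"

text \<open>The factor is 1 + h and not exp h, since only the first order at h = 0 matters. The map
  is linear in \<open>p\<close>, so it also serves as its own tangent lift.\<close>

definition dilate :: "real \<Rightarrow> real^4 \<Rightarrow> real^4" where
  "dilate h p = vec4 ((1 + h) * p$1) ((1 + h) * p$2) ((1 + h) * p$3) (p$4)"

lemma axial_rotation_has_vector_derivative:
  "((\<lambda>h. axial_rotation h p) has_vector_derivative rotation_field p) (at 0)"
proof (rule has_vector_derivative_vec)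
  fix i :: 4
  show "((\<lambda>h. axial_rotation h p $ i) has_real_derivative rotation_field p $ i) (at 0)"
    using exhaust_4[of i]
    by (elim disjE; simp add: axial_rotation_def rotation_field_def; auto intro!: derivative_eq_intros)
qed

lemma dilate_has_vector_derivative:
  "((\<lambda>h. dilate h p) has_vector_derivative dilation_field p) (at 0)"
proof (rule has_vector_derivative_vec)
  fix i :: 4
  show "((\<lambda>h. dilate h p $ i) has_real_derivative dilation_field p $ i) (at 0)"
    using exhaust_4[of i]
    by (elim disjE; simp add: dilate_def dilation_field_def; auto intro!: derivative_eq_intros)
qed

lemma kerr_form_axial_rotation:
  "axial_rotation h v \<bullet> (kerr_cartesian m a (axial_rotation h p) *v axial_rotation h v) = v \<bullet> (kerr_cartesian m a p *v v)"
proof -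
  note trig = sin_cos_squared_add[of h]
  have "(axial_rotation h p $ 1)\<^sup>2 + (axial_rotation h p $ 2)\<^sup>2 + (axial_rotation h p $ 3)\<^sup>2 = (p$1)\<^sup>2 + (p$2)\<^sup>2 + (p$3)\<^sup>2"
    unfolding axial_rotation_def vec4_nth using trig by algebra
  then have r: "bl_r (axial_rotation h p) = bl_r p"
    by (simp add: bl_r_def)
  have "spatial_inner (axial_rotation h x) (axial_rotation h y) = spatial_inner x y" for x y
    unfolding axial_rotation_def spatial_inner_def vec4_nth using trig by algebra
  then have inner: "spatial_inner (axial_rotation h v) (axial_rotation h v) = spatial_inner v v"
    and radial: "radial_form (axial_rotation h p) (axial_rotation h v) = radial_form p v"
    by (simp_all add: radial_form_def r flip: spatial_inner_def)
  have "axial_rotation h p $ 1 * axial_rotation h v $ 2 - axial_rotation h p $ 2 * axial_rotation h v $ 1 = p$1 * v$2 - p$2 * v$1"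
    unfolding axial_rotation_def vec4_nth using trig by algebra
  then have axial: "axial_form (axial_rotation h p) (axial_rotation h v) = axial_form p v"
    by (simp add: axial_form_def r)
  have "axial_rotation h p $ 3 = p $ 3" "axial_rotation h v $ 4 = v $ 4"
    by (simp_all add: axial_rotation_def)
  then show ?thesis
    unfolding kerr_cartesian_form bl_lambda_def r inner radial axial by simp
qed

lemma kerr_cartesian_translate: "kerr_cartesian m a (p + h *\<^sub>R axis 4 1) = kerr_cartesian m a p"
  by (simp add: kerr_cartesian_def bl_r_def axis_def)

text \<open>Only the angular term lambda/r^2 times \<open>spatial_inner v v\<close> survives. A
  dilation by k fixes cos theta, multiplies r by k and the inner product by k^2, so k^2 (1 + a^2
  cos^2 theta / (k r)^2) results: the part in a does not change with h.\<close>

lemma kerr_form_dilate: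
  assumes r: "bl_r p > 0" and h: "1 + h > 0"
    and v: "v$4 = 0" "axial_form p v = 0" "radial_form p v = 0"
  shows "dilate h v \<bullet> (kerr_cartesian m a (dilate h p) *v dilate h v) =
    ((1 + h)\<^sup>2 + a\<^sup>2 * (p$3 / bl_r p)\<^sup>2 / (bl_r p)\<^sup>2) * spatial_inner v v"
proof -
  have "(dilate h p $ 1)\<^sup>2 + (dilate h p $ 2)\<^sup>2 + (dilate h p $ 3)\<^sup>2 =
      (1 + h)\<^sup>2 * ((p$1)\<^sup>2 + (p$2)\<^sup>2 + (p$3)\<^sup>2)"
    unfolding dilate_def vec4_nth by algebra
  then have r': "bl_r (dilate h p) = (1 + h) * bl_r p"
    using h by (simp add: bl_r_def real_sqrt_mult)
  have inner: "spatial_inner (dilate h x) (dilate h y) = (1 + h)\<^sup>2 * spatial_inner x y" for x y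
    unfolding dilate_def spatial_inner_def vec4_nth by algebra
  have radial: "radial_form (dilate h p) (dilate h v) = 0"
    using v(3) r inner[of p v] by (simp add: radial_form_def r' flip: spatial_inner_def)
  have "dilate h p $ 1 * dilate h v $ 2 - dilate h p $ 2 * dilate h v $ 1 =
      (1 + h)\<^sup>2 * (p$1 * v$2 - p$2 * v$1)"
    unfolding dilate_def vec4_nth by algebra
  then have axial: "axial_form (dilate h p) (dilate h v) = 0"
    using v(2) r by (simp add: axial_form_def)
  have 3: "dilate h p $ 3 / ((1 + h) * bl_r p) = p$3 / bl_r p" and 4: "dilate h v $ 4 = 0"
    using h v(1) by (simp_all add: dilate_def)
  define k where "k = 1 + h"
  show ?thesis
    unfolding kerr_cartesian_form bl_lambda_def r' inner radial axial k_def[symmetric] 3[folded k_def] 4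
    using r h by (simp add: k_def[symmetric] power_mult_distrib add_divide_distrib distrib_right)
qed

lemma kerr_form_dilate_derivative:
  assumes r: "bl_r p > 0"
    and v: "v$4 = 0" "axial_form p v = 0" "radial_form p v = 0"
  shows "((\<lambda>h. dilate h v \<bullet> (kerr_cartesian m a (dilate h p) *v dilate h v))
    has_real_derivative 2 * spatial_inner v v) (at 0)"
proof (rule has_field_derivative_transform_within_open)
  show "((\<lambda>h. ((1 + h)\<^sup>2 + a\<^sup>2 * (p$3 / bl_r p)\<^sup>2 / (bl_r p)\<^sup>2) * spatial_inner v v)
    has_real_derivative 2 * spatial_inner v v) (at 0)"
    by (auto intro!: derivative_eq_intros)
  \<comment> \<open>The closed form requires 1 + h to be positive, hence this interval.\<close>
  show "open {-1<..<1::real}" "(0::real) \<in> {-1<..<1}"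
    by auto
qed (use kerr_form_dilate[OF r _ v] in auto)

text \<open>The dilation field is r d/dr, so the angular part cancels. Where r and Delta are
  positive, the momentum has the sign of the derivative of r.\<close>

lemma kerr_form_dilation_field:
  assumes "bl_r p > 0"
  shows "v \<bullet> (kerr_cartesian m a p *v dilation_field p) =
    bl_lambda a p / kerr_delta m a (bl_r p) * bl_r p * radial_form p v"
proof -
  have "radial_form p (dilation_field p) = bl_r p"
    using assms bl_r_square[of p] by (simp add: radial_form_def dilation_field_def power2_eq_square field_simps)
  moreover have "axial_form p (dilation_field p) = 0" "dilation_field p $ 4 = 0"
    by (simp_all add: axial_form_def dilation_field_def)
  moreover have "spatial_inner v (dilation_field p) = bl_r p * radial_form p v"
    using assms by (simp add: spatial_inner_def radial_form_def dilation_field_def mult.commute)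
  ultimately show ?thesis
    unfolding kerr_cartesian_form by simp
qed

lemma bl_r_has_real_derivative:
  assumes "(\<gamma> has_vector_derivative v) (at s within I)" "bl_r (\<gamma> s) > 0"
  shows "((\<lambda>s. bl_r (\<gamma> s)) has_real_derivative radial_form (\<gamma> s) v) (at s within I)"
proof -
  have "(\<gamma> s $ 1)\<^sup>2 + (\<gamma> s $ 2)\<^sup>2 + (\<gamma> s $ 3)\<^sup>2 > 0"
    using assms(2) by (simp add: bl_r_def)
  then have "((\<lambda>s. sqrt ((\<gamma> s $ 1)\<^sup>2 + (\<gamma> s $ 2)\<^sup>2 + (\<gamma> s $ 3)\<^sup>2)) has_real_derivative
      radial_form (\<gamma> s) v) (at s within I)"
    by (auto intro!: derivative_eq_intros has_real_derivative_component[OF assms(1)]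
        simp: radial_form_def bl_r_def field_simps)
  then show ?thesis
    by (simp add: bl_r_def)
qed

section \<open>Geodesics of the Kerr spacetime\<close>

lemma axis_point_in_kerr_region:
  assumes "m + sqrt (m\<^sup>2 - a\<^sup>2) < \<bar>z\<bar>" "z \<noteq> 0"
  shows "vec4 0 0 z t \<in> kerr_region m a"
proof -
  have "bl_r (vec4 0 0 z t) = \<bar>z\<bar>"
    by (simp add: bl_r_def)
  moreover have "(cos (bl_theta (vec4 0 0 z t)))\<^sup>2 = 1"
    using assms(2) by (cases "z > 0") (simp_all add: bl_theta_def bl_r_def)
  ultimately show ?thesis
    using assms(1) by (simp add: kerr_region_def)
qed

text \<open>Here cos theta = 0, so the stationary limit lies at r = 2m. On the axis it lies lower
  when a is nonzero, and this gap is the obstruction.\<close>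

lemma kerr_region_equator:
  assumes "p \<in> kerr_region m a" "p $ 3 = 0" "m > 0"
  shows "bl_r p > 2 * m"
  using assms by (simp add: kerr_region_def bl_theta_def)

lemma derivative_zero_constant_on_unit_interval:
  fixes f :: "real \<Rightarrow> real"
  assumes "\<And>s. s \<in> {0..1} \<Longrightarrow> (f has_real_derivative 0) (at s within {0..1})"
    and "s \<in> {0..1}" "t \<in> {0..1}"
  shows "f s = f t"
proof -
  obtain c where "\<And>s. s \<in> {0..1} \<Longrightarrow> f s = c"
    using has_field_derivative_zero_constant[of "{0..1}" f] assms(1) by auto
  then show ?thesis
    using assms(2,3) by simp
qed

section \<open>Conservation laws along a Kerr geodesic\<close>

locale kerr_geodesic =
  fixes m a :: real and \<gamma> v w :: "real \<Rightarrow> real^4"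
  assumes m: "m > 0" and am: "a\<^sup>2 \<le> m\<^sup>2"
    and region: "\<And>s. s \<in> {0..1} \<Longrightarrow> \<gamma> s \<in> kerr_region m a"
    and velocity: "\<And>s. s \<in> {0..1} \<Longrightarrow> (\<gamma> has_vector_derivative v s) (at s within {0..1})"
    and acceleration: "\<And>s. s \<in> {0..1} \<Longrightarrow> (v has_vector_derivative w s) (at s within {0..1})"
    and equation: "\<And>s k. s \<in> {0..1} \<Longrightarrow> w s $ k +
      (\<Sum>i\<in>UNIV. \<Sum>j\<in>UNIV. christoffel (kerr_cartesian m a) (\<gamma> s) k i j * v s $ i * v s $ j) = 0"
begin

abbreviation metric :: "real \<Rightarrow> real^4^4" where
  "metric s \<equiv> kerr_cartesian m a (\<gamma> s)"

lemma regular: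
  assumes "s \<in> {0..1}"
  shows "bl_r (\<gamma> s) > 0" "kerr_delta m a (bl_r (\<gamma> s)) > 0"
  by (rule kerr_region_regular[OF m region[OF assms] am])+

lemma metric_has_derivative:
  assumes "s \<in> {0..1}"
  obtains G where "(kerr_cartesian m a has_derivative G) (at (\<gamma> s))"
proof -
  have "kerr_delta m a (bl_r (\<gamma> s)) \<noteq> 0"
    using regular(2)[OF assms] by simp
  then show ?thesis
    using that differentiable_kerr_cartesian[OF regular(1)[OF assms]] unfolding differentiable_def by blast
qed

lemma momentum:
  assumes "s \<in> {0..1}"
    and "(y has_vector_derivative y') (at s within {0..1})"
    and "(c has_vector_derivative y s) (at 0)" "c 0 = \<gamma> s"
    and "(u has_vector_derivative y') (at 0)" "u 0 = v s"
    and "((\<lambda>h. u h \<bullet> (kerr_cartesian m a (c h) *v u h)) has_real_derivative D) (at 0)"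
  shows "((\<lambda>s. v s \<bullet> (metric s *v y s)) has_real_derivative D / 2) (at s within {0..1})"
proof -
  obtain G where G: "(kerr_cartesian m a has_derivative G) (at (\<gamma> s))"
    using metric_has_derivative[OF assms(1)] .
  note s = assms(1)
  show ?thesis
    using G invertible_kerr_cartesian[OF m region[OF s] am] transpose_kerr_cartesian
      velocity[OF s] acceleration[OF s] equation[OF s] assms(2-)
    by (rule geodesic_momentum[where g = "kerr_cartesian m a" and \<gamma> = \<gamma> and v = v and s = s
          and w = "w s" and y = y and y' = y' and c = c and u = u and D = D and I = "{0..1}" and G = G])
qed

lemma angular_momentum_constant:
  assumes "s \<in> {0..1}" "t \<in> {0..1}"
  shows "v s \<bullet> (metric s *v rotation_field (\<gamma> s)) = v t \<bullet> (metric t *v rotation_field (\<gamma> t))"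
proof (rule derivative_zero_constant_on_unit_interval[OF _ assms])
  fix s :: real assume s: "s \<in> {0..1}"
  have "((\<lambda>s. v s \<bullet> (metric s *v rotation_field (\<gamma> s))) has_real_derivative 0 / 2) (at s within {0..1})"
    by (rule momentum[OF s bounded_linear.has_vector_derivative[OF bounded_linear_rotation_field velocity[OF s]]
          axial_rotation_has_vector_derivative _ axial_rotation_has_vector_derivative])
      (simp_all add: kerr_form_axial_rotation, simp_all add: axial_rotation_def vec_eq_iff forall_4)
  then show "((\<lambda>s. v s \<bullet> (metric s *v rotation_field (\<gamma> s))) has_real_derivative 0) (at s within {0..1})"
    by simp
qed

lemma energy_constant:
  assumes "s \<in> {0..1}" "t \<in> {0..1}"
  shows "v s \<bullet> (metric s *v axis 4 1) = v t \<bullet> (metric t *v axis 4 1)"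
proof (rule derivative_zero_constant_on_unit_interval[OF _ assms])
  fix s :: real assume s: "s \<in> {0..1}"
  have "((\<lambda>s. v s \<bullet> (metric s *v axis 4 1)) has_real_derivative 0 / 2) (at s within {0..1})"
    \<comment> \<open>The field is constant, so \<open>y'\<close> is 0, and time translations leave
      tangent vectors unchanged, whence the constant \<open>u\<close>.\<close>
    by (rule momentum[OF s, where y' = 0 and c = "\<lambda>h. \<gamma> s + h *\<^sub>R axis 4 1" and u = "\<lambda>_. v s"])
      (auto simp: kerr_cartesian_translate intro!: derivative_eq_intros)
  then show "((\<lambda>s. v s \<bullet> (metric s *v axis 4 1)) has_real_derivative 0) (at s within {0..1})"
    by simp
qed

lemma speed_constant:
  assumes "s \<in> {0..1}" "t \<in> {0..1}"
  shows "v s \<bullet> (metric s *v v s) = v t \<bullet> (metric t *v v t)"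
proof (rule derivative_zero_constant_on_unit_interval[OF _ assms])
  fix s :: real assume s: "s \<in> {0..1}"
  obtain G where "(kerr_cartesian m a has_derivative G) (at (\<gamma> s))"
    using metric_has_derivative[OF s] .
  then show "((\<lambda>s. v s \<bullet> (metric s *v v s)) has_real_derivative 0) (at s within {0..1})"
    by (rule geodesic_energy[OF _ invertible_kerr_cartesian[OF m region[OF s] am]
          transpose_kerr_cartesian velocity[OF s] acceleration[OF s] equation[OF s]])
qed

lemma at_interior: "0 < s \<Longrightarrow> s < 1 \<Longrightarrow> at s within {0..1} = at (s::real)"
  by (rule at_within_interior) simp

section \<open>Geodesics without motion in t and phi\<close>

lemma static:
  assumes "\<gamma> 0 \<notin> off_axis" "\<gamma> 0 $ 4 = \<gamma> 1 $ 4" "s \<in> {0..1}"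
  shows "v s $ 4 = 0" "axial_form (\<gamma> s) (v s) = 0"
proof -
  have "rotation_field (\<gamma> 0) = 0"
    using assms(1)
    by (simp add: off_axis_def not_less sum_power2_le_zero_iff rotation_field_def vec_eq_iff forall_4)
  then have "v t \<bullet> (metric t *v rotation_field (\<gamma> t)) = 0" if "t \<in> {0..1}" for t
    using angular_momentum_constant[OF that, of 0] by simp
  then have energy: "\<exists>b>0. v t \<bullet> (metric t *v axis 4 1) = - b * v t $ 4 \<and>
      (v t $ 4 = 0 \<longrightarrow> axial_form (\<gamma> t) (v t) = 0)" if "t \<in> {0..1}" for t
    using zero_angular_momentum_energy[OF m region[OF that] am] that by metis
  have t_deriv: "((\<lambda>s. \<gamma> s $ 4) has_real_derivative v t $ 4) (at t within {0..1})" if "t \<in> {0..1}" for t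
    by (rule has_real_derivative_component[OF velocity[OF that]])
  have "\<exists>\<tau>>0. \<tau> < 1 \<and> (\<lambda>h. h * v \<tau> $ 4) = (\<lambda>h. 0)"
  proof (rule Rolle_deriv[of 0 1 "\<lambda>s. \<gamma> s $ 4" "\<lambda>s h. h * v s $ 4"])
    show "continuous_on {0..1} (\<lambda>s. \<gamma> s $ 4)"
      using t_deriv by (rule DERIV_continuous_on)
    fix \<tau> :: real assume "0 < \<tau>" "\<tau> < 1"
    then show "((\<lambda>s. \<gamma> s $ 4) has_derivative (\<lambda>h. h * v \<tau> $ 4)) (at \<tau>)"
      using t_deriv[of \<tau>]
      by (auto simp: at_interior has_field_derivative_def mult.commute[of _ "v \<tau> $ 4"])
  qed (use assms(2) in auto)
  then obtain \<tau> where \<tau>: "0 < \<tau>" "\<tau> < 1" "v \<tau> $ 4 = 0"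
    by (metis mult_1)
  \<comment> \<open>The factor \<open>b\<close> varies along the curve. It is therefore the
    conserved energy that carries the zero from \<open>\<tau>\<close> to \<open>s\<close>, where it
    is turned back into \<open>v s $ 4 = 0\<close>.\<close>
  then have "v s \<bullet> (metric s *v axis 4 1) = 0"
    using energy[of \<tau>] energy_constant[OF assms(3), of \<tau>] by auto
  then show "v s $ 4 = 0" "axial_form (\<gamma> s) (v s) = 0"
    using energy[OF assms(3)] by auto
qed

text \<open>The squared speed is constant and positive definite on these velocities, so one zero of
  the velocity makes it zero throughout. This stands in for uniqueness of solutions of the geodesic
  equation.\<close>

lemma static_stationary:
  assumes static: "\<And>s. s \<in> {0..1} \<Longrightarrow> v s $ 4 = 0 \<and> axial_form (\<gamma> s) (v s) = 0"
    and "s \<in> {0..1}" "v s = 0"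
  shows "\<gamma> 0 = \<gamma> 1"
proof -
  have "v t = 0" if "t \<in> {0..1}" for t
    using speed_constant[OF that assms(2)] assms(3) static[OF that]
    by (intro kerr_form_zero_imp_zero[OF regular[OF that]]) auto
  then have "((\<lambda>t. \<gamma> t $ i) has_real_derivative 0) (at t within {0..1})" if "t \<in> {0..1}" for t i
    using has_real_derivative_component[OF velocity[OF that], of i] that by simp
  then have "\<gamma> 0 $ i = \<gamma> 1 $ i" for i
    by (rule derivative_zero_constant_on_unit_interval) simp_all
  then show ?thesis
    by (simp add: vec_eq_iff)
qed

text \<open>
  The momentum along the dilation field is a positive multiple of the derivative of \<open>r\<close>, and it
  increases strictly where it vanishes; so an interior maximum of \<open>r\<close> is impossible.
\<close>

lemma static_no_interior_maximum:
  assumes static: "\<And>s. s \<in> {0..1} \<Longrightarrow> v s $ 4 = 0 \<and> axial_form (\<gamma> s) (v s) = 0"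
    and ends: "\<gamma> 0 \<noteq> \<gamma> 1"
    and s0: "0 < s0" "s0 < 1"
    and max: "\<And>s. s \<in> {0..1} \<Longrightarrow> bl_r (\<gamma> s) \<le> bl_r (\<gamma> s0)"
  shows False
proof -
  have s0': "s0 \<in> {0..1}"
    using s0 by simp
  have r_deriv: "((\<lambda>s. bl_r (\<gamma> s)) has_real_derivative radial_form (\<gamma> s) (v s)) (at s)"
    if "0 < s" "s < 1" for s
    using bl_r_has_real_derivative[OF velocity[of s] regular(1)[of s]] that by (simp add: at_interior)
  have critical: "radial_form (\<gamma> s0) (v s0) = 0"
  proof (rule DERIV_local_max[OF r_deriv[OF s0]])
    show "0 < min s0 (1 - s0)"
      using s0 by simp
    show "\<forall>s. \<bar>s0 - s\<bar> < min s0 (1 - s0) \<longrightarrow> bl_r (\<gamma> s) \<le> bl_r (\<gamma> s0)"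
      using max by (auto simp: abs_if split: if_splits)
  qed
  let ?P = "\<lambda>s. v s \<bullet> (metric s *v dilation_field (\<gamma> s))"
  have P: "?P s = bl_lambda a (\<gamma> s) / kerr_delta m a (bl_r (\<gamma> s)) * bl_r (\<gamma> s) * radial_form (\<gamma> s) (v s)"
    if "s \<in> {0..1}" for s
    by (rule kerr_form_dilation_field[OF regular(1)[OF that]])
  have "((?P) has_real_derivative 2 * spatial_inner (v s0) (v s0) / 2) (at s0 within {0..1})"
    by (rule momentum[OF s0' bounded_linear.has_vector_derivative[OF bounded_linear_dilation_field velocity[OF s0']]
          dilate_has_vector_derivative _ dilate_has_vector_derivative _
          kerr_form_dilate_derivative[OF regular(1)[OF s0'] _ _ critical]])
      (simp_all add: static[OF s0'], simp_all add: dilate_def vec_eq_iff forall_4)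
  then have P_deriv: "((?P) has_real_derivative spatial_inner (v s0) (v s0)) (at s0)"
    using s0 by (simp add: at_interior)
  \<comment> \<open>Needed to make the derivative of \<open>?P\<close> at \<open>s0\<close>, the
    Euclidean squared length of the velocity, strictly positive.\<close>
  have "v s0 \<noteq> 0"
    using static_stationary[OF static s0'] ends by blast
  then have "v s0 $ 1 \<noteq> 0 \<or> v s0 $ 2 \<noteq> 0 \<or> v s0 $ 3 \<noteq> 0"
    using static[OF s0'] by (auto simp: vec_eq_iff forall_4)
  then have "spatial_inner (v s0) (v s0) > 0"
    unfolding spatial_inner_def
    by (smt (verit) mult_eq_0_iff zero_le_square)
  then obtain d where d: "d > 0" "\<And>h. 0 < h \<Longrightarrow> h < d \<Longrightarrow> ?P s0 < ?P (s0 + h)"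
    using DERIV_pos_inc_right[OF P_deriv] by blast
  \<comment> \<open>At \<open>s0\<close> the momentum is 0, hence it is positive on the next
    \<open>d\<close> units to the right. Halving the minimum keeps \<open>s1\<close> below both
    \<open>s0 + d\<close> and 1.\<close>
  define s1 where "s1 = s0 + min d (1 - s0) / 2"
  have s1: "s0 < s1" "s1 < 1" "s1 < s0 + d"
    using d(1) s0 by (auto simp: s1_def min_def field_simps)
  have increasing: "radial_form (\<gamma> s) (v s) > 0" if "s0 < s" "s < s1" for s
  proof -
    have s: "s \<in> {0..1}"
      using that s0 s1 by simp
    have "bl_lambda a (\<gamma> s) > 0"
      using regular(1)[OF s] by (simp add: bl_lambda_def add_pos_nonneg)
    then have "bl_lambda a (\<gamma> s) / kerr_delta m a (bl_r (\<gamma> s)) * bl_r (\<gamma> s) > 0"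
      using regular[OF s] by simp
    moreover have "?P s > 0"
      using d(2)[of "s - s0"] that s1 P[OF s0'] critical by simp
    ultimately show ?thesis
      unfolding P[OF s] by (metis zero_less_mult_pos)
  qed
  have "bl_r (\<gamma> s0) < bl_r (\<gamma> s1)"
  proof (rule DERIV_pos_imp_increasing_open[OF s1(1)])
    fix s assume "s0 < s" "s < s1"
    then show "\<exists>y. ((\<lambda>s. bl_r (\<gamma> s)) has_real_derivative y) (at s) \<and> 0 < y"
      using s0 s1 by (intro exI[of _ "radial_form (\<gamma> s) (v s)"] conjI r_deriv increasing) simp_all
  next
    have "isCont (\<lambda>s. bl_r (\<gamma> s)) s" if "s \<in> {s0..s1}" for s
      using that s0 s1 by (intro DERIV_isCont[OF r_deriv]) simp_all
    then show "continuous_on {s0..s1} (\<lambda>s. bl_r (\<gamma> s))"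
      by (simp add: continuous_at_imp_continuous_on)
  qed
  then show False
    using max[of s1] s0 s1 by simp
qed

end

section \<open>Two axis points that no geodesic joins\<close>

theorem theorem4:
  fixes m a :: real
  assumes "m > 0" and "0 < a\<^sup>2" and "a\<^sup>2 \<le> m\<^sup>2"
  shows "\<not> geodesically_connected (kerr_metric m a) (kerr_region m a)"
proof
  assume connected: "geodesically_connected (kerr_metric m a) (kerr_region m a)"
  define r where "r = m + sqrt (m\<^sup>2 - a\<^sup>2)"
  \<comment> \<open>Since a is nonzero, the inequality is strict and leaves room for
    \<open>z\<close> between the axis radius of the limit surface and 2m.\<close>
  have "sqrt (m\<^sup>2 - a\<^sup>2) < m"
    using assms by (simp add: real_less_lsqrt)
  then have "r < 2 * m"
    by (simp add: r_def)
  then obtain z where z: "r < z" "z < 2 * m"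
    using dense by blast
  have "r > 0"
    using assms by (simp add: r_def add_pos_nonneg)
  with z have "z > 0"
    by simp
  with z have "vec4 0 0 z 0 \<in> kerr_region m a" "vec4 0 0 (- z) 0 \<in> kerr_region m a"
    by (auto intro!: axis_point_in_kerr_region simp: r_def)
  then obtain \<gamma> where "geodesic_on (kerr_metric m a) (kerr_region m a) {0..1} \<gamma>"
    and ends: "\<gamma> 0 = vec4 0 0 z 0" "\<gamma> 1 = vec4 0 0 (- z) 0"
    using connected unfolding geodesically_connected_def by blast
  then have "geodesic_on (kerr_cartesian m a) (kerr_region m a) {0..1} \<gamma>"
    using geodesic_on_cong[OF kerr_metric_eventually_cartesian[OF assms(1) _ assms(3)]] by blast
  then obtain v w where "kerr_geodesic m a \<gamma> v w"
    using assms unfolding geodesic_on_def kerr_geodesic_def by blast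
  then interpret kerr_geodesic m a \<gamma> v w .
  have static: "v s $ 4 = 0 \<and> axial_form (\<gamma> s) (v s) = 0" if "s \<in> {0..1}" for s
    using static[OF _ _ that] ends by (simp add: off_axis_def)
  have cont: "continuous_on {0..1} \<gamma>"
    using velocity by (rule continuous_on_vector_derivative)
  then have "continuous_on {0..1} (\<lambda>s. bl_r (\<gamma> s))"
    unfolding bl_r_def by (intro continuous_intros)
  then obtain s0 where s0: "s0 \<in> {0..1}" "\<And>s. s \<in> {0..1} \<Longrightarrow> bl_r (\<gamma> s) \<le> bl_r (\<gamma> s0)"
    using continuous_attains_sup[of "{0..1}" "\<lambda>s. bl_r (\<gamma> s)"] by auto
  have "continuous_on {0..1} (\<lambda>s. \<gamma> s $ 3)"
    using cont by (intro continuous_intros)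
  \<comment> \<open>The third coordinate runs from \<open>z\<close> to \<open>- z\<close>, so the
    curve crosses the equatorial plane.\<close>
  then obtain s1 where s1: "s1 \<in> {0..1}" "\<gamma> s1 $ 3 = 0"
    using IVT2'[of "\<lambda>s. \<gamma> s $ 3" 1 0 0] ends \<open>z > 0\<close> by auto
  then have "bl_r (\<gamma> s0) > 2 * m"
    using kerr_region_equator[OF region[OF s1(1)] s1(2) assms(1)] s0(2)[OF s1(1)] by simp
  moreover have "bl_r (\<gamma> 0) = z" "bl_r (\<gamma> 1) = z"
    using ends \<open>z > 0\<close> by (simp_all add: bl_r_def)
  \<comment> \<open>The maximum of r exceeds 2m while both ends have r = \<open>z\<close> < 2m, so
    it is attained in the interior.\<close>
  ultimately have "s0 \<noteq> 0" "s0 \<noteq> 1"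
    using z by auto
  moreover have "\<gamma> 0 \<noteq> \<gamma> 1"
  proof
    assume "\<gamma> 0 = \<gamma> 1"
    then have "\<gamma> 0 $ 3 = \<gamma> 1 $ 3"
      by simp
    then show False
      using ends \<open>z > 0\<close> by simp
  qed
  ultimately show False
    using static_no_interior_maximum[OF static _ _ _ s0(2)] s0(1) by auto
qed

end
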